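(* Let $L\ge 1$ and let $T'_L\in\mathbb R^{N\times N}$, $N=\sum_{\ell=1}^L N(\ell)$, be the block lower triangular matrix with blocks $(T'_L)_{kj}=\mathfrak X_{kj}=B_{kj}A_j^{-1}\in\mathbb R^{N(k)\times N(j)}$ for $k>j$, $(T'_L)_{kk}=\mathrm{id}_{N(k)}$, and $(T'_L)_{kj}=0$ for $k<j$ ($1\le k,j\le L$). Then $T'_L$ is invertible and the blocks of its inverse are $$\big((T'_L)^{-1}\big)_{kj}=\begin{cases}\displaystyle\sum_{\mathbf p\in P_{kj}}(-1)^{|\mathbf p|-1}\,\mathfrak X_{\mathbf p}, & k>j,\\ 0,& k<j,\\ \mathrm{id}_{N(k)},& k=j.\end{cases}$$ Moreover, for every $\mathbf y=(\mathbf y_1,\dots,\mathbf y_L)^T\in\mathbb R^N\cong\mathbb R^{N(1)}\times\dots\times\mathbb R^{N(L)}$, the $k$-th block of $(T'_L)^{-1}\mathbf y$ is $$\big((T'_L)^{-1}\mathbf y\big)_k=\mathbf y_k+\sum_{\ell=1}^{k-1}\ \sum_{\mathbf p\in P_{k\ell}}(-1)^{|\mathbf p|-1}\,\mathfrak X_{\mathbf p}\,\mathbf y_\ell,\qquad 1\le k\le L$$ (so the first block is $\mathbf y_1$ and the second is $-\mathfrak X_{21}\mathbf y_1+\mathbf y_2$).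
   Context: Kernel: $\Phi:\mathbb R^d\to\mathbb R$ is a radial function with support in the closed unit ball whose Fourier transform satisfies $c_\Phi(1+\|\omega\|_2^2)^{-\tau}\le\widehat\Phi(\omega)\le C_\Phi(1+\|\omega\|_2^2)^{-\tau}$ for some $\tau>d/2$ and $c_\Phi,C_\Phi>0$; in particular $\Phi$ is strictly positive definite. For $\delta>0$ set $\Phi_\delta(x)=\delta^{-d}\Phi(x/\delta)$. Point sets: for $1\le\ell\le L$, $X_\ell=\{x^{(\ell)}_1,\dots,x^{(\ell)}_{N(\ell)}\}\subset\Omega\subset\mathbb R^d$ is a finite set of $N(\ell)$ distinct points, $\delta_\ell>0$ is a scaling parameter, and $\Phi_\ell:=\Phi_{\delta_\ell}$. Matrices: $B_{k\ell}\in\mathbb R^{N(k)\times N(\ell)}$ has entries $(B_{k\ell})_{ij}=\Phi_\ell(x^{(k)}_i-x^{(\ell)}_j)$; $A_\ell:=B_{\ell\ell}$, which is symmetric positive definite; $\mathfrak X_{k\ell}:=B_{k\ell}A_\ell^{-1}$. Index sets: for natural numbers $k>j$ and $m\ge2$, $P^{(m)}_{kj}=\{(i_1,\dots,i_m)\in\mathbb N^m: k=i_1>i_2>\dots>i_m=j\}$ and $P_{kj}=\bigcup_{m=2}^{k-j+1}P^{(m)}_{kj}$. For $\mathbf p=(p_1,\dots,p_m)\in P^{(m)}_{kj}$ put $|\mathbf p|=m$ and $\mathfrak X_{\mathbf p}:=\mathfrak X_{p_1p_2}\mathfrak X_{p_2p_3}\cdots\mathfrak X_{p_{m-1}p_m}$.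 *)

theory Defs
  imports "HOL-Analysis.Analysis" "Jordan_Normal_Form.Gauss_Jordan_Elimination"
begin

text \<open>
  The kernel lives on the type \<open>real ^ 'd\<close>, whose norm is the Euclidean one. All matrices have
  sizes given by natural numbers and are those of \<open>Jordan_Normal_Form.Matrix\<close>. Their rows and columns are
  numbered from 0, whereas the levels are numbered from 1 to \<open>L\<close>.
\<close>

definition radial :: "(real ^ 'd \<Rightarrow> real) \<Rightarrow> bool" where
  "radial f \<longleftrightarrow> (\<exists>g. \<forall>x. f x = g (norm x))"

text \<open>The unitary normalisation; any other one only changes the constants in the bounds below.\<close>

definition fourier_transform :: "(real ^ 'd \<Rightarrow> real) \<Rightarrow> real ^ 'd \<Rightarrow> complex" where
  "fourier_transform f \<omega> =
     complex_of_real ((2 * pi) powr (- (real CARD('d) / 2))) *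
       (LINT x|lborel. complex_of_real (f x) * cis (- inner x \<omega>))"

text \<open>
  Continuity makes the pointwise values of the kernel (in particular the one at the origin)
  meaningful; the Fourier bounds alone determine it only up to null sets, and would not make it
  strictly positive definite. With the compact support it also gives integrability.
\<close>

definition admissible_kernel :: "real \<Rightarrow> real \<Rightarrow> real \<Rightarrow> (real ^ 'd \<Rightarrow> real) \<Rightarrow> bool" where
  "admissible_kernel \<tau> c C \<Phi> \<longleftrightarrow>
     continuous_on UNIV \<Phi> \<and> radial \<Phi> \<and> closure {x. \<Phi> x \<noteq> 0} \<subseteq> cball 0 1 \<and>
     \<tau> > real CARD('d) / 2 \<and> c > 0 \<and> C > 0 \<and>
     (\<forall>\<omega>. fourier_transform \<Phi> \<omega> \<in> \<real> \<and>
          c * (1 + (norm \<omega>)\<^sup>2) powr (- \<tau>) \<le> Re (fourier_transform \<Phi> \<omega>) \<and>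
          Re (fourier_transform \<Phi> \<omega>) \<le> C * (1 + (norm \<omega>)\<^sup>2) powr (- \<tau>))"

definition scaled_kernel :: "(real ^ 'd \<Rightarrow> real) \<Rightarrow> real \<Rightarrow> real ^ 'd \<Rightarrow> real" where
  "scaled_kernel \<Phi> \<delta> x = (1 / \<delta> ^ CARD('d)) * \<Phi> (x /\<^sub>R \<delta>)"

text \<open>
  \<open>mat_inverse\<close> returns an option; on singular matrices the total function \<open>mat_inv\<close> has a
  meaningless value of the right dimensions.
\<close>

definition mat_inv :: "real mat \<Rightarrow> real mat" where
  "mat_inv A = (case mat_inverse A of Some B \<Rightarrow> B | None \<Rightarrow> 0\<^sub>m (dim_row A) (dim_col A))"

lemma mat_inv_inverse:
  assumes A: "A \<in> carrier_mat n n" and inv: "invertible_mat A"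
  shows "mat_inv A \<in> carrier_mat n n" "A * mat_inv A = 1\<^sub>m n" "mat_inv A * A = 1\<^sub>m n"
proof -
  from inv obtain B where "A * B = 1\<^sub>m n" "B * A = 1\<^sub>m (dim_row B)"
    using A unfolding invertible_mat_def inverts_mat_def by auto
  moreover from this have "B \<in> carrier_mat n n"
    by (metis A carrier_mat_triv carrier_matD(2) index_mult_mat(2,3) index_one_mat(2,3))
  ultimately have "A \<in> Units (ring_mat TYPE(real) n ())"
    using A unfolding Units_def ring_mat_def by auto
  then obtain C where C: "mat_inverse A = Some C"
    using mat_inverse(1)[OF A, where b = "()"] by (cases "mat_inverse A") auto
  show "mat_inv A \<in> carrier_mat n n" "A * mat_inv A = 1\<^sub>m n" "mat_inv A * A = 1\<^sub>m n"
    using mat_inverse(2)[OF A C] C by (auto simp: mat_inv_def)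
qed

text \<open>
  In the following, \<open>N l\<close> is the number of points of level \<open>l\<close>, and \<open>x l i\<close> for \<open>i < N l\<close>
  are the points.
\<close>

definition B_mat ::
  "(real ^ 'd \<Rightarrow> real) \<Rightarrow> (nat \<Rightarrow> real) \<Rightarrow> (nat \<Rightarrow> nat) \<Rightarrow> (nat \<Rightarrow> nat \<Rightarrow> real ^ 'd) \<Rightarrow>
    nat \<Rightarrow> nat \<Rightarrow> real mat" where
  "B_mat \<Phi> \<delta> N x k l =
     Matrix.mat (N k) (N l) (\<lambda>(i, j). scaled_kernel \<Phi> (\<delta> l) (x k i - x l j))"

definition A_mat ::
  "(real ^ 'd \<Rightarrow> real) \<Rightarrow> (nat \<Rightarrow> real) \<Rightarrow> (nat \<Rightarrow> nat) \<Rightarrow> (nat \<Rightarrow> nat \<Rightarrow> real ^ 'd) \<Rightarrow>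
    nat \<Rightarrow> real mat" where
  "A_mat \<Phi> \<delta> N x l = B_mat \<Phi> \<delta> N x l l"

definition X_mat ::
  "(real ^ 'd \<Rightarrow> real) \<Rightarrow> (nat \<Rightarrow> real) \<Rightarrow> (nat \<Rightarrow> nat) \<Rightarrow> (nat \<Rightarrow> nat \<Rightarrow> real ^ 'd) \<Rightarrow>
    nat \<Rightarrow> nat \<Rightarrow> real mat" where
  "X_mat \<Phi> \<delta> N x k l = B_mat \<Phi> \<delta> N x k l * mat_inv (A_mat \<Phi> \<delta> N x l)"

definition paths_of_length :: "nat \<Rightarrow> nat \<Rightarrow> nat \<Rightarrow> nat list set" where
  "paths_of_length m k j =
     {p. length p = m \<and> p \<noteq> [] \<and> hd p = k \<and> last p = j \<and> sorted_wrt (>) p}"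

definition paths :: "nat \<Rightarrow> nat \<Rightarrow> nat list set" where
  "paths k j = (\<Union>m\<in>{2..k - j + 1}. paths_of_length m k j)"

text \<open>
  The product along a path; it ends with a harmless identity factor, and the value on the empty
  list is irrelevant.
\<close>

fun X_path ::
  "(real ^ 'd \<Rightarrow> real) \<Rightarrow> (nat \<Rightarrow> real) \<Rightarrow> (nat \<Rightarrow> nat) \<Rightarrow> (nat \<Rightarrow> nat \<Rightarrow> real ^ 'd) \<Rightarrow>
    nat list \<Rightarrow> real mat" where
  "X_path \<Phi> \<delta> N x [] = 1\<^sub>m 0"
| "X_path \<Phi> \<delta> N x [a] = 1\<^sub>m (N a)"
| "X_path \<Phi> \<delta> N x (a # b # p) = X_mat \<Phi> \<delta> N x a b * X_path \<Phi> \<delta> N x (b # p)"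

text \<open>
  Block matrices: level \<open>k\<close> occupies the indices from \<open>block_offset N k\<close> up to but excluding
  \<open>block_offset N (Suc k)\<close>.
\<close>

definition block_offset :: "(nat \<Rightarrow> nat) \<Rightarrow> nat \<Rightarrow> nat" where
  "block_offset N k = (\<Sum>l = 1..<k. N l)"

definition level_of :: "(nat \<Rightarrow> nat) \<Rightarrow> nat \<Rightarrow> nat" where
  "level_of N r = (LEAST k. r < block_offset N (Suc k))"

definition block_matrix ::
  "nat \<Rightarrow> (nat \<Rightarrow> nat) \<Rightarrow> (nat \<Rightarrow> nat \<Rightarrow> real mat) \<Rightarrow> real mat" where
  "block_matrix L N F =
     Matrix.mat (\<Sum>l = 1..L. N l) (\<Sum>l = 1..L. N l)
       (\<lambda>(r, s). let k = level_of N r; j = level_of N s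
                 in F k j $$ (r - block_offset N k, s - block_offset N j))"

definition mat_block :: "(nat \<Rightarrow> nat) \<Rightarrow> real mat \<Rightarrow> nat \<Rightarrow> nat \<Rightarrow> real mat" where
  "mat_block N M k j =
     Matrix.mat (N k) (N j) (\<lambda>(a, b). M $$ (block_offset N k + a, block_offset N j + b))"

definition vec_block :: "(nat \<Rightarrow> nat) \<Rightarrow> real Matrix.vec \<Rightarrow> nat \<Rightarrow> real Matrix.vec" where
  "vec_block N y k = Matrix.vec (N k) (\<lambda>a. vec_index y (block_offset N k + a))"

lemma block_offset_mono: "k \<le> k' \<Longrightarrow> block_offset N k \<le> block_offset N k'"
  unfolding block_offset_def by (rule sum_mono2) auto

lemma block_offset_Suc: "1 \<le> k \<Longrightarrow> block_offset N (Suc k) = block_offset N k + N k"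
  unfolding block_offset_def by simp

lemma level_of_block:
  assumes "1 \<le> k" "a < N k"
  shows "level_of N (block_offset N k + a) = k"
  unfolding level_of_def
proof (rule Least_equality)
  show "block_offset N k + a < block_offset N (Suc k)"
    using assms block_offset_Suc[of k N] by simp
next
  fix y assume y: "block_offset N k + a < block_offset N (Suc y)"
  show "k \<le> y"
  proof (rule ccontr)
    assume "\<not> k \<le> y"
    then have "block_offset N (Suc y) \<le> block_offset N k" by (intro block_offset_mono) simp
    with y show False by simp
  qed
qed

lemma block_index_less:
  assumes "k \<in> {1..L}" "a < N k"
  shows "block_offset N k + a < (\<Sum>l = 1..L. N l)"
proof -
  have "block_offset N k + a < block_offset N (Suc k)"
    using assms block_offset_Suc[of k N] by simp
  also have "\<dots> \<le> block_offset N (Suc L)" using assms by (intro block_offset_mono) simp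
  also have "\<dots> = (\<Sum>l = 1..L. N l)"
    by (simp add: block_offset_def atLeastLessThanSuc_atLeastAtMost)
  finally show ?thesis .
qed

lemma mat_block_block_matrix:
  assumes "k \<in> {1..L}" "j \<in> {1..L}" "F k j \<in> carrier_mat (N k) (N j)"
  shows "mat_block N (block_matrix L N F) k j = F k j"
proof (rule eq_matI)
  fix a b assume "a < dim_row (F k j)" "b < dim_col (F k j)"
  then have ab: "a < N k" "b < N j" using assms(3) by auto
  then show "mat_block N (block_matrix L N F) k j $$ (a, b) = F k j $$ (a, b)"
    using assms block_index_less[of k L a N] block_index_less[of j L b N] ab
    by (simp add: mat_block_def block_matrix_def level_of_block)
qed (use assms in \<open>auto simp: mat_block_def\<close>)

definition T_mat ::
  "(real ^ 'd \<Rightarrow> real) \<Rightarrow> (nat \<Rightarrow> real) \<Rightarrow> (nat \<Rightarrow> nat) \<Rightarrow> (nat \<Rightarrow> nat \<Rightarrow> real ^ 'd) \<Rightarrow>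
    nat \<Rightarrow> real mat" where
  "T_mat \<Phi> \<delta> N x L = block_matrix L N
     (\<lambda>k j. if k > j then X_mat \<Phi> \<delta> N x k j
            else if k = j then 1\<^sub>m (N k)
            else 0\<^sub>m (N k) (N j))"

end

theory Submission
  imports Defs "Jordan_Normal_Form.Determinant"
begin

text \<open>
  Counting \<open>[k]\<close> as a path from \<open>k\<close> to \<open>k\<close> makes the claimed blocks of the inverse uniform: block
  \<open>(k, j)\<close> is \<open>G k j\<close>, the signed sum over all strictly decreasing paths from \<open>k\<close> to \<open>j\<close>.
  Splitting a path after its first node gives \<open>G k j = - (\<Sum>l\<in>{j..<k}. X k l * G l j)\<close> for
  \<open>k > j\<close>, which says exactly that \<open>G\<close> is a right inverse of the block triangular matrix. Since
  that matrix is square, \<open>G\<close> is its inverse.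
\<close>

notation vec_index (infixl "$v" 100)

section \<open>Strictly decreasing paths and their recursion\<close>

definition decreasing_paths :: "nat \<Rightarrow> nat \<Rightarrow> nat list set" where
  "decreasing_paths k j = {p. p \<noteq> [] \<and> hd p = k \<and> last p = j \<and> sorted_wrt (>) p}"

text \<open>Between neighbouring nodes the value drops by at least 1, so a path has at most k - j +
  1 nodes. As a path is nonempty, the same inequality rules out k < j and leaves only the one-node
  path when k = j.\<close>

lemma length_decreasing_path:
  assumes "p \<in> decreasing_paths k j"
  shows "length p + j \<le> k + 1"
proof -
  have "sorted_wrt (>) p \<Longrightarrow> p \<noteq> [] \<Longrightarrow> length p + last p \<le> hd p + 1" for p :: "nat list"
  proof (induction p)
    case (Cons a p)
    then show ?case by (cases p) auto
  qed simp
  with assms show ?thesis by (auto simp: decreasing_paths_def)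
qed

text \<open>Distinct endpoints force at least two nodes, and the length bound gives at most k - j +
  1, so the range of lengths in \<open>paths\<close> excludes nothing. For k = j the two sets
  differ: \<open>paths k k\<close> is empty, whereas \<open>[k]\<close> is a decreasing
  path.\<close>

lemma paths_eq_decreasing_paths:
  assumes "j < k"
  shows "paths k j = decreasing_paths k j"
proof -
  have "2 \<le> length p" if "p \<in> decreasing_paths k j" for p
    using that assms by (cases p; cases "tl p") (auto simp: decreasing_paths_def)
  then show ?thesis
    using length_decreasing_path[of _ k j] assms
    unfolding paths_def paths_of_length_def
    by (fastforce simp: decreasing_paths_def)
qed

lemma decreasing_paths_less: "k < j \<Longrightarrow> decreasing_paths k j = {}"
proof -
  assume "k < j"
  have "False" if "p \<in> decreasing_paths k j" for p
    using length_decreasing_path[OF that] that \<open>k < j\<close> by (cases p) (auto simp: decreasing_paths_def)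
  then show ?thesis by blast
qed

lemma decreasing_paths_refl: "decreasing_paths k k = {[k]}"
proof -
  have "p = [k]" if "p \<in> decreasing_paths k k" for p
    using length_decreasing_path[OF that] that by (cases p) (auto simp: decreasing_paths_def)
  then show ?thesis by (auto simp: decreasing_paths_def)
qed

text \<open>Here l is the second node. It is below k because the path decreases, and at least j
  because otherwise no path leads from l to j; l = j is the direct step. Conversely, every node of a
  path starting at l < k is below k, so k may be prepended.\<close>

lemma decreasing_paths_step:
  assumes "j < k"
  shows "decreasing_paths k j = (\<Union>l\<in>{j..<k}. (#) k ` decreasing_paths l j)"
proof (intro equalityI subsetI)
  fix p assume p: "p \<in> decreasing_paths k j"
  then obtain q where q: "p = k # q" by (cases p) (auto simp: decreasing_paths_def)
  with p assms have q': "q \<in> decreasing_paths (hd q) j" "q \<noteq> []"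
    by (auto simp: decreasing_paths_def)
  have "hd q < k" using p q q' by (auto simp: decreasing_paths_def)
  moreover have "j \<le> hd q" using decreasing_paths_less[of "hd q" j] q' by (cases "hd q < j") auto
  ultimately show "p \<in> (\<Union>l\<in>{j..<k}. (#) k ` decreasing_paths l j)"
    using q q' by (intro UN_I[of "hd q"]) auto
next
  fix p assume "p \<in> (\<Union>l\<in>{j..<k}. (#) k ` decreasing_paths l j)"
  then obtain l q where q: "l < k" "q \<in> decreasing_paths l j" "p = k # q" by auto
  then have "\<forall>y\<in>set q. y < k" by (cases q) (auto simp: decreasing_paths_def)
  with q show "p \<in> decreasing_paths k j" by (auto simp: decreasing_paths_def)
qed

text \<open>Strong induction on the start: the recursion writes the set as a finite union of images
  of path sets with a smaller start.\<close>

lemma finite_decreasing_paths: "finite (decreasing_paths k j)"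
proof (induction k rule: less_induct)
  case (less k)
  then show ?case
    by (cases k j rule: linorder_cases)
      (auto simp: decreasing_paths_less decreasing_paths_refl decreasing_paths_step)
qed

section \<open>Dimensions of the factors and of the path products\<close>

lemma mat_inv_carrier: "A \<in> carrier_mat n n \<Longrightarrow> mat_inv A \<in> carrier_mat n n"
  \<comment> \<open>For singular \<open>A\<close> the default value is a zero matrix with the
    dimensions of \<open>A\<close>.\<close>
  using mat_inverse(2)[of A n] by (auto simp: mat_inv_def split: option.split)

lemma X_mat_carrier [simp]: "X_mat \<Phi> \<delta> N x k l \<in> carrier_mat (N k) (N l)"
proof -
  have "A_mat \<Phi> \<delta> N x l \<in> carrier_mat (N l) (N l)" by (simp add: A_mat_def B_mat_def)
  then have "mat_inv (A_mat \<Phi> \<delta> N x l) \<in> carrier_mat (N l) (N l)" by (rule mat_inv_carrier)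
  then show ?thesis by (auto simp: X_mat_def B_mat_def)
qed

lemma dim_X_mat [simp]:
  "dim_row (X_mat \<Phi> \<delta> N x k l) = N k" "dim_col (X_mat \<Phi> \<delta> N x k l) = N l"
  by (rule carrier_matD[OF X_mat_carrier])+

lemma X_path_carrier:
  "p \<noteq> [] \<Longrightarrow> X_path \<Phi> \<delta> N x p \<in> carrier_mat (N (hd p)) (N (last p))"
  by (induction p rule: induct_list012) (auto intro: mult_carrier_mat[OF X_mat_carrier])

lemma X_path_carrier_decreasing:
  "p \<in> decreasing_paths k j \<Longrightarrow> X_path \<Phi> \<delta> N x p \<in> carrier_mat (N k) (N j)"
  using X_path_carrier by (auto simp: decreasing_paths_def)

lemma dim_X_path_decreasing:
  assumes "p \<in> decreasing_paths k j"
  shows "dim_row (X_path \<Phi> \<delta> N x p) = N k" "dim_col (X_path \<Phi> \<delta> N x p) = N j"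
  by (rule carrier_matD[OF X_path_carrier_decreasing[OF assms]])+

section \<open>Finite sums in the module of matrices, entry by entry\<close>

lemma finsum_mat_carrier_index:
  fixes f :: "_ \<Rightarrow> 'a::comm_ring_1 mat"
  assumes "finite P" "f \<in> P \<rightarrow> carrier_mat m n"
  shows "finsum (module_mat TYPE('a) m n) f P \<in> carrier_mat m n"
    and "a < m \<Longrightarrow> b < n \<Longrightarrow>
      finsum (module_mat TYPE('a) m n) f P $$ (a, b) = (\<Sum>p\<in>P. f p $$ (a, b))"
proof -
  interpret abelian_group "module_mat TYPE('a) m n" by (rule abelian_group_mat)
  \<comment> \<open>Both claims go through one induction, since reading off an entry of the enlarged
    sum requires the dimensions of the smaller one.\<close>
  have "finsum (module_mat TYPE('a) m n) f P \<in> carrier_mat m n \<and>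
    (a < m \<longrightarrow> b < n \<longrightarrow>
      finsum (module_mat TYPE('a) m n) f P $$ (a, b) = (\<Sum>p\<in>P. f p $$ (a, b)))"
    using assms
  proof (induction P rule: finite_induct)
    case empty
    then show ?case using finsum_empty[of f] by (simp add: module_mat_def)
  next
    case (insert p P)
    then show ?case using finsum_insert[of P p f] by (auto simp: module_mat_simps Pi_iff)
  qed
  then show "finsum (module_mat TYPE('a) m n) f P \<in> carrier_mat m n"
    and "a < m \<Longrightarrow> b < n \<Longrightarrow>
      finsum (module_mat TYPE('a) m n) f P $$ (a, b) = (\<Sum>p\<in>P. f p $$ (a, b))"
    by auto
qed

section \<open>Indexing by level and position within the level\<close>

lemma block_offset_Suc_top: "block_offset N (Suc L) = (\<Sum>l = 1..L. N l)"
  by (simp add: block_offset_def atLeastLessThanSuc_atLeastAtMost)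

text \<open>The indices are consecutive intervals of lengths \<open>N l\<close>. This turns the sum
  over all indices in a matrix product into a sum over levels.\<close>

lemma sum_blocks:
  fixes f :: "nat \<Rightarrow> 'a::comm_monoid_add"
  shows "(\<Sum>s<(\<Sum>l = 1..L. N l). f s) = (\<Sum>l = 1..L. \<Sum>a<N l. f (block_offset N l + a))"
proof (induction L)
  case (Suc L)
  have "(\<Sum>s<m + n. f s) = (\<Sum>s<m. f s) + (\<Sum>a<n. f (m + a))" for m n :: nat
    by (induction n) (auto simp: add.assoc)
  with Suc show ?case by (simp add: block_offset_Suc_top)
qed simp

text \<open>Complements \<open>level_of_block\<close>: every index has block coordinates. In the
  induction on L, an index lies either before the last block or inside it.\<close>

lemma block_index_cases:
  assumes "r < (\<Sum>l = 1..L. N l)"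
  obtains k a where "k \<in> {1..L}" "a < N k" "r = block_offset N k + a"
proof -
  have "\<exists>k\<in>{1..L}. \<exists>a<N k. r = block_offset N k + a" using assms
  proof (induction L)
    case (Suc L)
    show ?case
    proof (cases "r < (\<Sum>l = 1..L. N l)")
      case True
      then show ?thesis using Suc.IH by force
    next
      case False
      then have "r - block_offset N (Suc L) < N (Suc L)"
        "r = block_offset N (Suc L) + (r - block_offset N (Suc L))"
        using Suc.prems by (auto simp: block_offset_Suc_top)
      then show ?thesis by fastforce
    qed
  qed simp
  then show thesis using that by blast
qed

lemma block_matrix_index:
  assumes "k \<in> {1..L}" "j \<in> {1..L}" "a < N k" "b < N j"
  shows "block_matrix L N F $$ (block_offset N k + a, block_offset N j + b) = F k j $$ (a, b)"
  using assms block_index_less[of k L a N] block_index_less[of j L b N]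
  by (simp add: block_matrix_def level_of_block)

lemma block_matrix_carrier:
  "block_matrix L N F \<in> carrier_mat (\<Sum>l = 1..L. N l) (\<Sum>l = 1..L. N l)"
  by (simp add: block_matrix_def)

section \<open>Signed path sums and their recursion\<close>

definition signed_path_sum ::
  "(real ^ 'd \<Rightarrow> real) \<Rightarrow> (nat \<Rightarrow> real) \<Rightarrow> (nat \<Rightarrow> nat) \<Rightarrow> (nat \<Rightarrow> nat \<Rightarrow> real ^ 'd) \<Rightarrow>
    nat \<Rightarrow> nat \<Rightarrow> real mat" where
  "signed_path_sum \<Phi> \<delta> N x k j = Matrix.mat (N k) (N j) (\<lambda>ab.
     \<Sum>p\<in>decreasing_paths k j. (-1) ^ (length p - 1) * X_path \<Phi> \<delta> N x p $$ ab)"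

lemma signed_path_sum_carrier [simp]:
  "signed_path_sum \<Phi> \<delta> N x k j \<in> carrier_mat (N k) (N j)"
  by (simp add: signed_path_sum_def)

lemma signed_path_sum_less: "k < j \<Longrightarrow> signed_path_sum \<Phi> \<delta> N x k j = 0\<^sub>m (N k) (N j)"
  by (auto simp: signed_path_sum_def decreasing_paths_less)

lemma signed_path_sum_refl: "signed_path_sum \<Phi> \<delta> N x k k = 1\<^sub>m (N k)"
  by (auto simp: signed_path_sum_def decreasing_paths_refl)

text \<open>The entrywise definition lets the argument rearrange ordinary real sums; this converts
  it to the module sum over \<open>paths\<close> in which the theorem is phrased.\<close>

lemma signed_path_sum_greater:
  assumes "j < k"
  shows "signed_path_sum \<Phi> \<delta> N x k j =
    finsum (module_mat TYPE(real) (N k) (N j))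
      (\<lambda>p. (-1) ^ (length p - 1) \<cdot>\<^sub>m X_path \<Phi> \<delta> N x p) (paths k j)"
  (is "_ = finsum ?M ?f _")
proof -
  have P: "finite (paths k j)" "?f \<in> paths k j \<rightarrow> carrier_mat (N k) (N j)"
    by (auto simp: paths_eq_decreasing_paths[OF assms] finite_decreasing_paths
        X_path_carrier_decreasing)
  note X = dim_X_path_decreasing[where k = k and j = j]
  show ?thesis
    using finsum_mat_carrier_index[OF P]
    by (intro eq_matI)
      (auto simp: signed_path_sum_def paths_eq_decreasing_paths[OF assms] X intro!: sum.cong)
qed

text \<open>Group the paths by their second node l. Prepending k to a path from l multiplies its
  product by \<open>X_mat\<close> for (k, l) on the left and, adding one node, flips its
  sign.\<close>

lemma signed_path_sum_step:
  assumes "j < k" "a < N k" "b < N j"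
  shows "signed_path_sum \<Phi> \<delta> N x k j $$ (a, b) =
    - (\<Sum>l\<in>{j..<k}. \<Sum>c<N l. X_mat \<Phi> \<delta> N x k l $$ (a, c) * signed_path_sum \<Phi> \<delta> N x l j $$ (c, b))"
proof -
  let ?D = "\<lambda>l. decreasing_paths l j"
  \<comment> \<open>The row is an argument because the tail of a path is evaluated at the summation
    index c instead of a.\<close>
  let ?g = "\<lambda>a p. (-1) ^ (length p - 1) * X_path \<Phi> \<delta> N x p $$ (a, b)"
  have cons: "?g a (k # q) = - (\<Sum>c<N l. X_mat \<Phi> \<delta> N x k l $$ (a, c) * ?g c q)"
    if q: "q \<in> ?D l" for l q
  proof -
    \<comment> \<open>Exposing the head of q unfolds the two-node equation of \<open>X_path\<close>;
      it also makes the truncated subtraction in the exponent exact, so that the exponent really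
      grows by 1.\<close>
    obtain q' where q': "q = l # q'" using q by (cases q) (auto simp: decreasing_paths_def)
    have "X_path \<Phi> \<delta> N x q \<in> carrier_mat (N l) (N j)" using q by (rule X_path_carrier_decreasing)
    then have "X_path \<Phi> \<delta> N x (k # q) $$ (a, b) =
        (\<Sum>c<N l. X_mat \<Phi> \<delta> N x k l $$ (a, c) * X_path \<Phi> \<delta> N x q $$ (c, b))"
      using assms by (auto simp: q' scalar_prod_def lessThan_atLeast0 intro!: sum.cong)
    then show ?thesis
      by (simp add: q' sum_distrib_left sum_negf[symmetric] mult_ac)
  qed
  have "signed_path_sum \<Phi> \<delta> N x k j $$ (a, b) = sum (?g a) (?D k)"
    using assms by (simp add: signed_path_sum_def)
  also have "\<dots> = (\<Sum>l\<in>{j..<k}. sum (?g a) ((#) k ` ?D l))"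
    unfolding decreasing_paths_step[OF assms(1)]
  proof (rule sum.UNION_disjoint)
    \<comment> \<open>The tails of paths in different classes have different heads.\<close>
    show "\<forall>l\<in>{j..<k}. \<forall>l'\<in>{j..<k}. l \<noteq> l' \<longrightarrow> (#) k ` ?D l \<inter> (#) k ` ?D l' = {}"
      by (auto simp: decreasing_paths_def)
  qed (simp_all add: finite_decreasing_paths)
  also have "\<dots> = (\<Sum>l\<in>{j..<k}. \<Sum>q\<in>?D l. ?g a (k # q))"
    by (rule sum.cong) (simp_all add: sum.reindex)
  also have "\<dots> = (\<Sum>l\<in>{j..<k}. \<Sum>q\<in>?D l. - (\<Sum>c<N l. X_mat \<Phi> \<delta> N x k l $$ (a, c) * ?g c q))"
    by (intro sum.cong refl cons)
  also have "\<dots> = - (\<Sum>l\<in>{j..<k}. \<Sum>c<N l. \<Sum>q\<in>?D l. X_mat \<Phi> \<delta> N x k l $$ (a, c) * ?g c q)"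
    unfolding sum_negf by (intro arg_cong[of _ _ uminus] sum.cong refl sum.swap)
  also have "\<dots> = - (\<Sum>l\<in>{j..<k}. \<Sum>c<N l. X_mat \<Phi> \<delta> N x k l $$ (a, c) * signed_path_sum \<Phi> \<delta> N x l j $$ (c, b))"
    using assms(3) by (intro arg_cong[of _ _ uminus] sum.cong refl) (simp add: signed_path_sum_def sum_distrib_left)
  finally show ?thesis .
qed

section \<open>The inverse of the block triangular matrix\<close>

lemma block_mult_index:
  assumes "k \<in> {1..L}" "j \<in> {1..L}" "a < N k" "b < N j"
  shows "(block_matrix L N F * block_matrix L N G) $$ (block_offset N k + a, block_offset N j + b) =
    (\<Sum>l = 1..L. \<Sum>c<N l. F k l $$ (a, c) * G l j $$ (c, b))"
proof -
  let ?n = "\<Sum>l = 1..L. N l" and ?r = "block_offset N k + a" and ?s = "block_offset N j + b"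
  let ?F = "block_matrix L N F" and ?G = "block_matrix L N G"
  have "?r < ?n" "?s < ?n" using assms by (auto intro!: block_index_less simp del: One_nat_def)
  then have "(?F * ?G) $$ (?r, ?s) = (\<Sum>t<?n. ?F $$ (?r, t) * ?G $$ (t, ?s))"
    using block_matrix_carrier[of L N F] block_matrix_carrier[of L N G]
    by (auto simp: scalar_prod_def lessThan_atLeast0 intro!: sum.cong)
  also have "\<dots> = (\<Sum>l = 1..L. \<Sum>c<N l. F k l $$ (a, c) * G l j $$ (c, b))"
    unfolding sum_blocks using assms by (intro sum.cong refl) (simp add: block_matrix_index)
  finally show ?thesis .
qed

lemma T_mat_mult_signed_path_sum:
  "T_mat \<Phi> \<delta> N x L * block_matrix L N (signed_path_sum \<Phi> \<delta> N x) = 1\<^sub>m (\<Sum>l = 1..L. N l)"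
  (is "?T * ?S = 1\<^sub>m ?n")
proof (rule eq_matI)
  let ?X = "X_mat \<Phi> \<delta> N x" and ?G = "signed_path_sum \<Phi> \<delta> N x"
  define F where "F k j = (if k > j then ?X k j else if k = j then 1\<^sub>m (N k) else 0\<^sub>m (N k) (N j))"
    for k j
  have T: "?T = block_matrix L N F" unfolding T_mat_def F_def ..
  fix r s assume "r < dim_row (1\<^sub>m ?n :: real mat)" "s < dim_col (1\<^sub>m ?n :: real mat)"
  then have "r < ?n" "s < ?n" by auto
  then obtain k a j b where k: "k \<in> {1..L}" "a < N k" "r = block_offset N k + a"
    and j: "j \<in> {1..L}" "b < N j" "s = block_offset N j + b"
    by (metis block_index_cases)
  define h where "h l = (\<Sum>c<N l. F k l $$ (a, c) * ?G l j $$ (c, b))" for l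
  have h_greater: "h l = 0" if "k < l" for l
    using that k by (simp add: h_def F_def)
  have h_less: "h l = 0" if "l < j" for l
    using that j by (simp add: h_def signed_path_sum_less)
  have h_k: "h k = ?G k j $$ (a, b)"
    using k by (simp add: h_def F_def if_distrib[of "\<lambda>z. z * _"] sum.delta' cong: if_cong)
  have "(?T * ?S) $$ (r, s) = sum h {1..L}"
    using k j by (simp add: T block_mult_index h_def)
  \<comment> \<open>Only levels l from j to k contribute: \<open>F\<close> vanishes above the
    diagonal, and no path leads from l to j when l < j. The range is empty when k < j, which settles
    that case below.\<close>
  also have "\<dots> = sum h {j..k}"
    using k j by (intro sum.mono_neutral_right) (auto intro: h_greater h_less simp: not_le)
  also have "\<dots> = (if k = j \<and> a = b then 1 else 0)"
  proof (cases k j rule: linorder_cases)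
    case greater
    \<comment> \<open>The identity block at l = k contributes the path sum itself; by the recursion
      the remaining levels contribute its negative.\<close>
    then have "{j..k} = insert k {j..<k}" by auto
    moreover have "sum h {j..<k} = - ?G k j $$ (a, b)"
      using greater k j by (simp add: signed_path_sum_step h_def F_def)
    ultimately show ?thesis using greater h_k by simp
  next
    case equal
    then show ?thesis using h_k k j by (simp add: signed_path_sum_refl)
  qed simp
  also have "k = j \<and> a = b \<longleftrightarrow> r = s"
    \<comment> \<open>The level, hence also the position within it, can be recovered from the
      index.\<close>
    using k j level_of_block[of k a N] level_of_block[of j b N] by auto
  finally show "(?T * ?S) $$ (r, s) = 1\<^sub>m ?n $$ (r, s)"
    using \<open>r < ?n\<close> \<open>s < ?n\<close> by simp
qed (simp_all add: T_mat_def block_matrix_def)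

lemma T_mat_carrier: "T_mat \<Phi> \<delta> N x L \<in> carrier_mat (\<Sum>l = 1..L. N l) (\<Sum>l = 1..L. N l)"
  unfolding T_mat_def by (rule block_matrix_carrier)

lemma invertible_T_mat: "invertible_mat (T_mat \<Phi> \<delta> N x L)"
  and mat_inv_T_mat:
    "mat_inv (T_mat \<Phi> \<delta> N x L) = block_matrix L N (signed_path_sum \<Phi> \<delta> N x)"
proof -
  let ?T = "T_mat \<Phi> \<delta> N x L" and ?S = "block_matrix L N (signed_path_sum \<Phi> \<delta> N x)"
  let ?n = "\<Sum>l = 1..L. N l"
  note T = T_mat_carrier[of \<Phi> \<delta> N x L] and S = block_matrix_carrier[of L N "signed_path_sum \<Phi> \<delta> N x"]
  note TS = T_mat_mult_signed_path_sum[of \<Phi> \<delta> N x L]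
  have ST: "?S * ?T = 1\<^sub>m ?n" using mat_mult_left_right_inverse[OF T S TS] .
  show inv: "invertible_mat ?T"
    using T S TS ST unfolding invertible_mat_def inverts_mat_def
    by (intro conjI exI[of _ ?S]) (auto simp: square_mat.simps)
  note I = mat_inv_inverse[OF T inv]
  \<comment> \<open>Uniqueness of inverses: inserting \<open>?T * ?S\<close>, which is the identity,
    and reassociating identifies the matrix chosen by \<open>mat_inv\<close> with
    \<open>?S\<close>.\<close>
  have "mat_inv ?T = mat_inv ?T * (?T * ?S)" using I(1) TS by simp
  also have "\<dots> = ?S" using assoc_mult_mat[OF I(1) T S] I(3) S by simp
  finally show "mat_inv ?T = ?S" .
qed

section \<open>Action of the inverse on block vectors\<close>

lemma signed_path_sum_mult_vec:
  assumes "j < k" "v \<in> carrier_vec (N j)"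
  shows "signed_path_sum \<Phi> \<delta> N x k j *\<^sub>v v =
    finsum_vec TYPE(real) (N k)
      (\<lambda>p. ((-1) ^ (length p - 1) \<cdot>\<^sub>m X_path \<Phi> \<delta> N x p) *\<^sub>v v) (paths k j)"
  (is "?l = finsum_vec _ _ ?f ?P")
proof -
  note X = dim_X_path_decreasing[where k = k and j = j]
  have P: "finite ?P"
    by (simp add: paths_eq_decreasing_paths[OF assms(1)] finite_decreasing_paths)
  have f: "?f \<in> ?P \<rightarrow> carrier_vec (N k)"
    unfolding paths_eq_decreasing_paths[OF assms(1)]
    by (intro Pi_I mult_mat_vec_carrier[OF _ assms(2)] smult_carrier_mat X_path_carrier_decreasing)
  show ?thesis
  proof (rule eq_vecI)
    fix a assume "a < dim_vec (finsum_vec TYPE(real) (N k) ?f ?P)"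
    then have a: "a < N k" using finsum_vec_closed[OF f] by auto
    have "?l $v a = (\<Sum>c<N j. \<Sum>p\<in>?P. (-1) ^ (length p - 1) * X_path \<Phi> \<delta> N x p $$ (a, c) * v $v c)"
      using a assms
      by (auto simp: signed_path_sum_def scalar_prod_def paths_eq_decreasing_paths
          lessThan_atLeast0 sum_distrib_right intro!: sum.cong)
    \<comment> \<open>Exchanging columns and paths distributes the matrix-vector product over the
      path sum.\<close>
    also have "\<dots> = (\<Sum>p\<in>?P. ?f p $v a)"
      using a assms
      by (subst sum.swap) (auto simp: X scalar_prod_def paths_eq_decreasing_paths
          lessThan_atLeast0 intro!: sum.cong)
    also have "\<dots> = finsum_vec TYPE(real) (N k) ?f ?P $v a"
      using index_finsum_vec[OF P a f] by simp
    finally show "?l $v a = finsum_vec TYPE(real) (N k) ?f ?P $v a" .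
  qed (use finsum_vec_closed[OF f] in \<open>auto simp: signed_path_sum_def\<close>)
qed

text \<open>Specialises the congruence rule of commutative monoids to vectors; it asks that one of
  the two families take values in the carrier.\<close>

lemmas finsum_vec_cong =
  comm_monoid.finprod_cong'[OF comm_monoid_vec, folded finsum_vec_def, unfolded monoid_vec_simps]

lemma vec_block_carrier: "vec_block N y l \<in> carrier_vec (N l)"
  by (simp add: vec_block_def)

text \<open>In row k of the inverse, blocks to the right of the diagonal vanish and the diagonal
  block is the identity, which yields the separate summand; the levels below k remain.\<close>

lemma vec_block_mat_inv_T_mat:
  assumes k: "k \<in> {1..L}" and y: "y \<in> carrier_vec (\<Sum>l = 1..L. N l)"
  shows "vec_block N (mat_inv (T_mat \<Phi> \<delta> N x L) *\<^sub>v y) k =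
    vec_block N y k +
    finsum_vec TYPE(real) (N k) (\<lambda>l. signed_path_sum \<Phi> \<delta> N x k l *\<^sub>v vec_block N y l) {1..k - 1}"
  (is "_ = _ + finsum_vec _ _ ?f ?K")
proof (rule eq_vecI)
  let ?G = "signed_path_sum \<Phi> \<delta> N x" and ?n = "\<Sum>l = 1..L. N l"
  have f: "?f \<in> ?K \<rightarrow> carrier_vec (N k)"
    by (intro Pi_I mult_mat_vec_carrier[OF signed_path_sum_carrier vec_block_carrier])
  note F = finsum_vec_closed[OF f]
  show "dim_vec (vec_block N (mat_inv (T_mat \<Phi> \<delta> N x L) *\<^sub>v y) k) =
    dim_vec (vec_block N y k + finsum_vec TYPE(real) (N k) ?f ?K)"
    using F by (auto simp: vec_block_def)
  fix a assume "a < dim_vec (vec_block N y k + finsum_vec TYPE(real) (N k) ?f ?K)"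
  then have a: "a < N k" using F by auto
  define h where "h l = (\<Sum>c<N l. ?G k l $$ (a, c) * vec_block N y l $v c)" for l
  have "vec_block N (mat_inv (T_mat \<Phi> \<delta> N x L) *\<^sub>v y) k $v a =
      (\<Sum>s<?n. block_matrix L N ?G $$ (block_offset N k + a, s) * y $v s)"
    using a y block_index_less[of k L a N, OF k a] block_matrix_carrier[of L N ?G]
    by (auto simp: vec_block_def mat_inv_T_mat scalar_prod_def lessThan_atLeast0 intro!: sum.cong)
  also have "\<dots> = sum h {1..L}"
    unfolding sum_blocks h_def using k a
    by (intro sum.cong refl) (simp add: block_matrix_index vec_block_def)
  also have "\<dots> = sum h {1..k}"
    using k a by (intro sum.mono_neutral_right) (auto simp: h_def signed_path_sum_less)
  also have "{1..k} = insert k ?K" using k by auto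
  also have "sum h (insert k ?K) = h k + sum h ?K" using k by (intro sum.insert) auto
  also have "h k = vec_block N y k $v a"
    using a by (simp add: h_def signed_path_sum_refl if_distrib[of "\<lambda>z. z * _"] cong: if_cong)
  also have "sum h ?K = (\<Sum>l\<in>?K. ?f l $v a)"
    using a by (intro sum.cong refl)
      (auto simp: h_def signed_path_sum_def scalar_prod_def vec_block_def lessThan_atLeast0)
  also have "\<dots> = finsum_vec TYPE(real) (N k) ?f ?K $v a"
    using index_finsum_vec[OF _ a f] by simp
  finally show "vec_block N (mat_inv (T_mat \<Phi> \<delta> N x L) *\<^sub>v y) k $v a =
      (vec_block N y k + finsum_vec TYPE(real) (N k) ?f ?K) $v a"
    using a F by auto
qed

theorem theorem9:
  fixes \<Phi> :: "real ^ 'd \<Rightarrow> real" and \<tau> c C :: real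
    and \<Omega> :: "(real ^ 'd) set"
    and L :: nat and N :: "nat \<Rightarrow> nat"
    and x :: "nat \<Rightarrow> nat \<Rightarrow> real ^ 'd" and \<delta> :: "nat \<Rightarrow> real"
  assumes "admissible_kernel \<tau> c C \<Phi>"
    and "L \<ge> 1"
    and "\<And>l. l \<in> {1..L} \<Longrightarrow> \<delta> l > 0"
    and "\<And>l. l \<in> {1..L} \<Longrightarrow> inj_on (x l) {..<N l}"
    and "\<And>l. l \<in> {1..L} \<Longrightarrow> x l ` {..<N l} \<subseteq> \<Omega>"
  shows "invertible_mat (T_mat \<Phi> \<delta> N x L)
    \<and> (\<forall>k\<in>{1..L}. \<forall>j\<in>{1..L}.
         mat_block N (mat_inv (T_mat \<Phi> \<delta> N x L)) k j =
           (if k > j then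
              finsum (module_mat TYPE(real) (N k) (N j))
                (\<lambda>p. (-1) ^ (length p - 1) \<cdot>\<^sub>m X_path \<Phi> \<delta> N x p) (paths k j)
            else if k < j then 0\<^sub>m (N k) (N j)
            else 1\<^sub>m (N k)))
    \<and> (\<forall>y\<in>carrier_vec (\<Sum>l = 1..L. N l).
         (\<forall>k\<in>{1..L}.
            vec_block N (mat_inv (T_mat \<Phi> \<delta> N x L) *\<^sub>v y) k =
              vec_block N y k +
              finsum_vec TYPE(real) (N k)
                (\<lambda>l. finsum_vec TYPE(real) (N k)
                   (\<lambda>p. ((-1) ^ (length p - 1) \<cdot>\<^sub>m X_path \<Phi> \<delta> N x p) *\<^sub>v vec_block N y l)
                   (paths k l))
                {1..k - 1})
         \<and> vec_block N (mat_inv (T_mat \<Phi> \<delta> N x L) *\<^sub>v y) 1 = vec_block N y 1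
         \<and> (L \<ge> 2 \<longrightarrow>
              vec_block N (mat_inv (T_mat \<Phi> \<delta> N x L) *\<^sub>v y) 2 =
                - (X_mat \<Phi> \<delta> N x 2 1 *\<^sub>v vec_block N y 1) + vec_block N y 2))"
proof (intro conjI ballI impI)
  let ?G = "signed_path_sum \<Phi> \<delta> N x"
  show "invertible_mat (T_mat \<Phi> \<delta> N x L)" by (rule invertible_T_mat)
  {
    fix k j assume "k \<in> {1..L}" "j \<in> {1..L}"
    then have "mat_block N (mat_inv (T_mat \<Phi> \<delta> N x L)) k j = ?G k j"
      by (simp add: mat_inv_T_mat mat_block_block_matrix)
    then show "mat_block N (mat_inv (T_mat \<Phi> \<delta> N x L)) k j =
      (if k > j then
         finsum (module_mat TYPE(real) (N k) (N j))
           (\<lambda>p. (-1) ^ (length p - 1) \<cdot>\<^sub>m X_path \<Phi> \<delta> N x p) (paths k j)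
       else if k < j then 0\<^sub>m (N k) (N j)
       else 1\<^sub>m (N k))"
      by (cases k j rule: linorder_cases)
        (simp_all add: signed_path_sum_less signed_path_sum_refl signed_path_sum_greater)
  }
  fix y :: "real Matrix.vec" assume y: "y \<in> carrier_vec (\<Sum>l = 1..L. N l)"
  let ?z = "mat_inv (T_mat \<Phi> \<delta> N x L) *\<^sub>v y"
  {
    fix k assume k: "k \<in> {1..L}"
    have "finsum_vec TYPE(real) (N k)
          (\<lambda>l. finsum_vec TYPE(real) (N k)
             (\<lambda>p. ((-1) ^ (length p - 1) \<cdot>\<^sub>m X_path \<Phi> \<delta> N x p) *\<^sub>v vec_block N y l) (paths k l))
          {1..k - 1} =
        finsum_vec TYPE(real) (N k) (\<lambda>l. ?G k l *\<^sub>v vec_block N y l) {1..k - 1}"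
    \<comment> \<open>Each l in the outer range satisfies l < k, so its inner sum over
      \<open>paths k l\<close> is the action of \<open>?G k l\<close>.\<close>
    proof (rule finsum_vec_cong[OF refl])
      show "(\<lambda>l. ?G k l *\<^sub>v vec_block N y l) \<in> {1..k - 1} \<rightarrow> carrier_vec (N k)"
        by (intro Pi_I mult_mat_vec_carrier[OF signed_path_sum_carrier vec_block_carrier])
    qed (use k in \<open>auto simp: signed_path_sum_mult_vec[OF _ vec_block_carrier]\<close>)
    then show "vec_block N ?z k = vec_block N y k +
      finsum_vec TYPE(real) (N k)
        (\<lambda>l. finsum_vec TYPE(real) (N k)
           (\<lambda>p. ((-1) ^ (length p - 1) \<cdot>\<^sub>m X_path \<Phi> \<delta> N x p) *\<^sub>v vec_block N y l) (paths k l))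
        {1..k - 1}"
      using vec_block_mat_inv_T_mat[OF k y] by simp
  }
  \<comment> \<open>For k = 1 the range of l is empty, so the outer sum is the zero vector.\<close>
  show "vec_block N ?z 1 = vec_block N y 1"
    using vec_block_mat_inv_T_mat[of 1 L y N] y \<open>L \<ge> 1\<close> vec_block_carrier[of N y 1]
    by (simp add: finsum_vec_empty)
  assume "L \<ge> 2"
  \<comment> \<open>The second block involves a single path, with two nodes and therefore sign
    -1.\<close>
  have D: "decreasing_paths 2 1 = {[2, 1]}"
    using decreasing_paths_step[of 1 2] by (simp add: numeral_2_eq_2 decreasing_paths_refl)
  have "X_path \<Phi> \<delta> N x [2, 1] = X_mat \<Phi> \<delta> N x 2 1"
    \<comment> \<open>This removes the identity factor contributed by the last node of the
      path.\<close>
    using right_mult_one_mat[OF X_mat_carrier] by simp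
  then have "?G 2 1 = - X_mat \<Phi> \<delta> N x 2 1"
    unfolding signed_path_sum_def D by (intro eq_matI) simp_all
  then have G: "?G 2 1 *\<^sub>v vec_block N y 1 = - (X_mat \<Phi> \<delta> N x 2 1 *\<^sub>v vec_block N y 1)"
    using vec_block_carrier[of N y 1]
    by (intro eq_vecI) (auto simp: scalar_prod_def sum_negf)
  let ?f = "\<lambda>l. ?G 2 l *\<^sub>v vec_block N y l"
  have f: "?f l \<in> carrier_vec (N 2)" for l
    by (rule mult_mat_vec_carrier[OF signed_path_sum_carrier vec_block_carrier])
  then have "finsum_vec TYPE(real) (N 2) ?f {1} = ?f 1 + finsum_vec TYPE(real) (N 2) ?f {}"
    by (intro finsum_vec_insert) auto
  also have "\<dots> = ?f 1"
    using f[of 1] by (simp add: finsum_vec_empty)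
  finally have "finsum_vec TYPE(real) (N 2) ?f {1..2 - 1} = ?f 1" by simp
  then have "vec_block N ?z 2 = vec_block N y 2 + ?f 1"
    using vec_block_mat_inv_T_mat[of 2 L y N \<Phi> \<delta> x] y \<open>L \<ge> 2\<close> by simp
  also have "\<dots> = ?f 1 + vec_block N y 2"
    by (rule comm_add_vec[OF vec_block_carrier[of N y 2] f[of 1]])
  finally show "vec_block N ?z 2 = - (X_mat \<Phi> \<delta> N x 2 1 *\<^sub>v vec_block N y 1) + vec_block N y 2"
    unfolding G .
qed

end
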